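(* Let $k\ge3$ and let $\Pi\in\mathfrak{P}^{(k,2)}$ be a simple Poisson structure on $\mathbb{R}^n$ with non-vanishing trace, $D\Pi\neq0$. Then $\Pi$ has rank two (i.e. the maximum over $x\in\mathbb{R}^n$ of the rank of the skew matrix $(\Pi^{ij}(x))$ is $2$).
   Context: Let $V=\mathbb{R}^n$ with linear coordinates $x^1,\dots,x^n$ and $\partial_i=\partial/\partial x^i$. $\mathfrak{P}^{(k,\ell)}$ denotes the space of $\ell$-vector fields on $V$ whose coefficients are homogeneous polynomials of degree $k$. The trace operator $D:\mathfrak{P}^{(k,\ell)}\to\mathfrak{P}^{(k-1,\ell-1)}$ is given, for $U=\frac1{\ell!}U^{j_1\ldots j_\ell}\partial_{j_1}\wedge\cdots\wedge\partial_{j_\ell}$, by $D(U)=\frac{1}{(\ell-1)!}\partial_mU^{j_1\ldots j_{\ell-1}m}\partial_{j_1}\wedge\cdots\wedge\partial_{j_{\ell-1}}$. Set $e^{(k,\ell)}=\frac{1}{n+k-\ell}x^m\partial_m$ (sum over $m$). Every $A\in\mathfrak{P}^{(k,\ell)}$ (with $n+k-\ell\neq0$) is uniquely $A=A_0+DA\wedge e^{(k,\ell)}$ with $DA_0=0$; $A_0$ is called its trace-free part. A bi-vector field $\Pi$ is a Poisson structure if $[\Pi,\Pi]=0$ for the Schouten bracket. A Poisson structure $\Pi\in\mathfrak{P}^{(k,2)}$ is called simple if its trace-free part $\Pi_0$ is itself a Poisson structure. *)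

theory Defs
  imports "HOL-Analysis.Analysis"
begin

(* A multivector field U on real^'n is given by its contravariant components in the
   coordinates x^1,...,x^n: for l indices js = [j_1,...,j_l], "U js" is the coefficient
   function U^{j_1...j_l} of
     U = (1/l!) U^{j_1...j_l} d_{j_1} /\ ... /\ d_{j_l}.
   Components for index lists of the wrong length are 0, so that equality of l-vector
   fields is equality of functions. *)
type_synonym 'n mvf = "'n list \<Rightarrow> real^'n \<Rightarrow> real"

definition multivector_field :: "nat \<Rightarrow> ('n::finite) mvf \<Rightarrow> bool" where
  "multivector_field l U \<longleftrightarrow>
     (\<forall>js x. length js \<noteq> l \<longrightarrow> U js x = 0) \<and>
     (\<forall>js \<sigma> x. length js = l \<longrightarrow> \<sigma> permutes {..<l} \<longrightarrow>
        U (permute_list \<sigma> js) x = of_int (sign \<sigma>) * U js x)"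

definition homogeneous_polynomial :: "nat \<Rightarrow> (real^('n::finite) \<Rightarrow> real) \<Rightarrow> bool" where
  "homogeneous_polynomial k p \<longleftrightarrow>
     (\<exists>c :: ('n \<Rightarrow> nat) \<Rightarrow> real. \<forall>x.
        p x = (\<Sum>\<alpha>\<in>{\<alpha>. (\<Sum>i\<in>UNIV. \<alpha> i) = k}. c \<alpha> * (\<Prod>i\<in>UNIV. (x $ i) ^ \<alpha> i)))"

(* The space P^{(k,l)}. *)
definition hom_mvf :: "nat \<Rightarrow> nat \<Rightarrow> ('n::finite) mvf set" where
  "hom_mvf k l = {U. multivector_field l U \<and>
                     (\<forall>js. length js = l \<longrightarrow> homogeneous_polynomial k (U js))}"

definition pdiff :: "'n \<Rightarrow> (real^('n::finite) \<Rightarrow> real) \<Rightarrow> real^'n \<Rightarrow> real" where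
  "pdiff m f x = deriv (\<lambda>t. f (x + t *\<^sub>R axis m 1)) 0"

definition trace_op :: "('n::finite) mvf \<Rightarrow> 'n mvf" where
  "trace_op U = (\<lambda>js x. \<Sum>m\<in>UNIV. pdiff m (U (js @ [m])) x)"

(* Exterior product of a p-vector field and a q-vector field, normalised so that
   (d_{i_1} /\ ... /\ d_{i_p}) /\ (d_{j_1} /\ ... /\ d_{j_q}) is
   d_{i_1} /\ ... /\ d_{i_p} /\ d_{j_1} /\ ... /\ d_{j_q};
   for vector fields, (X /\ Y)^{ij} = X^i Y^j - X^j Y^i. *)
definition wedge :: "nat \<Rightarrow> nat \<Rightarrow> ('n::finite) mvf \<Rightarrow> 'n mvf \<Rightarrow> 'n mvf" where
  "wedge p q U W = (\<lambda>js x.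
     if length js = p + q then
       (\<Sum>\<sigma>\<in>{\<sigma>. \<sigma> permutes {..<p + q}}.
          of_int (sign \<sigma>) * U (take p (permute_list \<sigma> js)) x * W (drop p (permute_list \<sigma> js)) x)
       / (fact p * fact q)
     else 0)"

(* Schouten bracket of a p-vector field and a q-vector field. Writing xi_m for d_m regarded as
   an odd variable, this is
     [U,W] = sum_m (U <-d/dxi_m) (dW/dx^m) - (dU/dx^m) (d/dxi_m-> W),
   with the derivative in xi_m acting on U from the right and on W from the left. For vector
   fields it is the Lie bracket. If p = 0 (q = 0), the contraction of U (of W) vanishes because
   its components for nonempty index lists are 0, so the truncated subtraction is harmless. *)
definition schouten :: "nat \<Rightarrow> nat \<Rightarrow> ('n::finite) mvf \<Rightarrow> 'n mvf \<Rightarrow> 'n mvf" where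
  "schouten p q U W = (\<lambda>js x. \<Sum>m\<in>UNIV.
     wedge (p - 1) q (\<lambda>is. U (is @ [m])) (\<lambda>is. pdiff m (W is)) js x -
     wedge p (q - 1) (\<lambda>is. pdiff m (U is)) (\<lambda>is. W (m # is)) js x)"

(* The vector field e^{(k,l)} = x^m d_m / (n + k - l), with n + k - l computed in the reals. *)
definition euler_field :: "nat \<Rightarrow> nat \<Rightarrow> ('n::finite) mvf" where
  "euler_field k l = (\<lambda>js x. case js of
       [m] \<Rightarrow> x $ m / (real CARD('n) + real k - real l)
     | _ \<Rightarrow> 0)"

(* The A_0 in A = A_0 + DA /\ e^{(k,l)}, for A in P^{(k,l)} with n + k - l nonzero. *)
definition trace_free_part :: "nat \<Rightarrow> nat \<Rightarrow> ('n::finite) mvf \<Rightarrow> 'n mvf" where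
  "trace_free_part k l A =
     (\<lambda>js x. A js x - wedge (l - 1) 1 (trace_op A) (euler_field k l) js x)"

(* Only used for bi-vector fields with polynomial coefficients, so no smoothness is required. *)
definition poisson :: "('n::finite) mvf \<Rightarrow> bool" where
  "poisson P \<longleftrightarrow> multivector_field 2 P \<and> schouten 2 2 P P = (\<lambda>js x. 0)"

definition simple_poisson :: "nat \<Rightarrow> ('n::finite) mvf \<Rightarrow> bool" where
  "simple_poisson k P \<longleftrightarrow>
     P \<in> hom_mvf k 2 \<and> poisson P \<and> poisson (trace_free_part k 2 P)"

definition bivector_matrix :: "('n::finite) mvf \<Rightarrow> real^'n \<Rightarrow> real^'n^'n" where
  "bivector_matrix P x = (\<chi> i j. P [i, j] x)"

(* A maximum of a nonempty set of naturals bounded by n. *)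
definition bivector_rank :: "('n::finite) mvf \<Rightarrow> nat" where
  "bivector_rank P = Max (range (\<lambda>x. rank (bivector_matrix P x)))"

end

theory Submission
  imports Defs
begin

text \<open>
  Let \<open>\<Pi>\<close> be the given structure, \<open>X = D\<Pi>\<close> its trace, \<open>E = x\<^sup>m \<partial>\<^sub>m\<close> the Euler field and
  \<open>c = n + k - 2\<close>, so that the trace-free part is \<open>\<Pi>\<^sub>0 = \<Pi> - (X \<and> E) / c\<close>. The point is that
  \<open>X \<and> \<Pi> = 0\<close>; away from the zeros of \<open>X\<close> this makes \<open>\<Pi>\<close> a product of \<open>X\<close> with
  another vector.

  Taking the divergence of the Jacobi identity \<open>[\<Pi>,\<Pi>] = 0\<close> gives \<open>[X,\<Pi>] = 0\<close>
  (\<open>trace_preserves_poisson\<close>). Now expand \<open>[\<Pi>\<^sub>0,\<Pi>\<^sub>0] = 0\<close>. The term quadratic in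
  \<open>X \<and> E\<close> is a multiple of \<open>X \<and> E \<and> [X,E]\<close>, which vanishes because homogeneity of \<open>X\<close> makes
  \<open>[X,E]\<close> a multiple of \<open>X\<close>; the term quadratic in \<open>\<Pi>\<close> vanishes since \<open>\<Pi>\<close> is Poisson.
  The mixed term is built from \<open>[X,\<Pi>] \<and> E\<close>, which is zero, and
  \<open>X \<and> [E,\<Pi>] = (k - 2) X \<and> \<Pi>\<close>. As \<open>k \<noteq> 2\<close>, it follows that \<open>X \<and> \<Pi> = 0\<close>
  (\<open>trace_wedge_eq_0\<close>).

  Hence the Pluecker relations \<open>\<Pi>\<^sup>a\<^sup>b \<Pi>\<^sup>i\<^sup>j - \<Pi>\<^sup>a\<^sup>i \<Pi>\<^sup>b\<^sup>j + \<Pi>\<^sup>a\<^sup>j \<Pi>\<^sup>b\<^sup>i = 0\<close> hold wherever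
  \<open>X\<close> is non-zero. Their left-hand sides are polynomials, and a non-zero component of \<open>X\<close> is
  not a zero divisor, so they hold everywhere and bound the rank by two. The rank is two at some
  point because \<open>X \<noteq> 0\<close> forces \<open>\<Pi> \<noteq> 0\<close>, and a non-zero skew matrix has rank at least two.
\<close>

section \<open>Partial derivatives of polynomial functions\<close>

lemmas real_polynomial_function_linear = real_polynomial_function.intros(1)
  and real_polynomial_function_const = real_polynomial_function.intros(2)
  and real_polynomial_function_add = real_polynomial_function.intros(3)
  and real_polynomial_function_mult = real_polynomial_function.intros(4)

lemma has_derivative_pdiff:
  fixes f :: "real^'n::finite \<Rightarrow> real"
  assumes "real_polynomial_function f"
  shows "(f has_derivative (\<lambda>h. \<Sum>m\<in>UNIV. h $ m * pdiff m f x)) (at x)"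
proof -
  have "f differentiable (at x)"
    using assms differentiable_at_polynomial_function real_polynomial_function_eq by blast
  then obtain f' where f': "(f has_derivative f') (at x)"
    by (auto simp: differentiable_def)
  then have lin: "linear f'"
    using has_derivative_linear by blast
  have pdiff: "pdiff m f x = f' (axis m 1)" for m
  proof -
    have "((\<lambda>t. f (x + t *\<^sub>R axis m 1)) has_derivative (\<lambda>t. f' (t *\<^sub>R axis m 1))) (at 0)"
      by (rule has_derivative_compose[of "\<lambda>t. x + t *\<^sub>R axis m 1", where g = f])
        (auto intro!: derivative_eq_intros simp: f')
    then have "((\<lambda>t. f (x + t *\<^sub>R axis m 1)) has_real_derivative f' (axis m 1)) (at 0)"
      by (simp add: has_field_derivative_def linear_cmul[OF lin] mult.commute[of _ "f' (axis m 1)"])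
    then show ?thesis
      unfolding pdiff_def by (rule DERIV_imp_deriv)
  qed
  have "f' h = (\<Sum>m\<in>UNIV. h $ m * pdiff m f x)" for h
  proof -
    have "f' h = f' (\<Sum>m\<in>UNIV. h $ m *\<^sub>R axis m 1)"
      using basis_expansion[of h] by (simp add: scalar_mult_eq_scaleR)
    also have "\<dots> = (\<Sum>m\<in>UNIV. h $ m * pdiff m f x)"
      by (simp add: pdiff linear_sum[OF lin] linear_cmul[OF lin])
    finally show ?thesis .
  qed
  then have "f' = (\<lambda>h. \<Sum>m\<in>UNIV. h $ m * pdiff m f x)"
    by (rule ext)
  with f' show ?thesis by (rule subst[rotated])
qed

lemma has_real_derivative_pdiff:
  fixes f :: "real^'n::finite \<Rightarrow> real"
  assumes "real_polynomial_function f"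
  shows "((\<lambda>t. f (x + t *\<^sub>R axis m 1)) has_real_derivative pdiff m f x) (at 0)"
proof -
  have "((\<lambda>t. f (x + t *\<^sub>R axis m 1)) has_derivative
      (\<lambda>t. \<Sum>i\<in>UNIV. (t *\<^sub>R axis m 1) $ i * pdiff i f x)) (at 0)"
    by (rule has_derivative_compose[of "\<lambda>t. x + t *\<^sub>R axis m 1", where g = f])
      (auto intro!: derivative_eq_intros simp: has_derivative_pdiff[OF assms])
  moreover have "(\<Sum>i\<in>UNIV. (t *\<^sub>R axis m 1) $ i * pdiff i f x) = pdiff m f x * t" for t
    by (simp add: axis_def if_distrib if_distribR cong: if_cong)
  ultimately show ?thesis
    by (simp add: has_field_derivative_def)
qed

lemma pdiff_const [simp]: "pdiff m (\<lambda>x. c) = (\<lambda>x. 0)"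
  by (simp add: pdiff_def fun_eq_iff)

lemma pdiff_component: "pdiff m (\<lambda>x::real^'n::finite. x $ j) = (\<lambda>x. if m = j then 1 else 0)"
proof
  fix x :: "real^'n"
  have "((\<lambda>t. (x + t *\<^sub>R axis m 1) $ j) has_real_derivative (if m = j then 1 else 0)) (at 0)"
    by (auto simp: axis_def intro!: derivative_eq_intros)
  then show "pdiff m (\<lambda>x. x $ j) x = (if m = j then 1 else 0)"
    unfolding pdiff_def by (rule DERIV_imp_deriv)
qed

lemma pdiff_add:
  assumes "real_polynomial_function f" "real_polynomial_function g"
  shows "pdiff m (\<lambda>x. f x + g x) = (\<lambda>x. pdiff m f x + pdiff m g x)"
proof
  fix x
  show "pdiff m (\<lambda>x. f x + g x) x = pdiff m f x + pdiff m g x"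
    using DERIV_add[OF has_real_derivative_pdiff[OF assms(1)] has_real_derivative_pdiff[OF assms(2)]]
    by (subst pdiff_def) (rule DERIV_imp_deriv)
qed

lemma pdiff_mult:
  assumes "real_polynomial_function f" "real_polynomial_function g"
  shows "pdiff m (\<lambda>x. f x * g x) = (\<lambda>x. pdiff m f x * g x + f x * pdiff m g x)"
proof
  fix x
  show "pdiff m (\<lambda>x. f x * g x) x = pdiff m f x * g x + f x * pdiff m g x"
    using DERIV_mult[OF has_real_derivative_pdiff[OF assms(1), of x m]
        has_real_derivative_pdiff[OF assms(2), of x m]]
    by (subst pdiff_def) (auto dest!: DERIV_imp_deriv simp: mult.commute)
qed

lemma pdiff_minus:
  assumes "real_polynomial_function f"
  shows "pdiff m (\<lambda>x. - f x) = (\<lambda>x. - pdiff m f x)"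
  using pdiff_mult[OF real_polynomial_function_const[of "-1"] assms] by simp

lemma pdiff_diff:
  assumes "real_polynomial_function f" "real_polynomial_function g"
  shows "pdiff m (\<lambda>x. f x - g x) = (\<lambda>x. pdiff m f x - pdiff m g x)"
  using pdiff_add[OF assms(1) real_polynomial_function_minus[OF assms(2)]]
  by (simp add: pdiff_minus[OF assms(2)])

lemma pdiff_uminus_eq:
  assumes "real_polynomial_function f" "\<And>x. g x = - f x"
  shows "pdiff m g x = - pdiff m f x"
proof -
  have "g = (\<lambda>x. - f x)" using assms(2) by (rule ext)
  then show ?thesis using pdiff_minus[OF assms(1)] by (simp only:)
qed

lemma pdiff_sum:
  assumes "finite I" "\<And>i. i \<in> I \<Longrightarrow> real_polynomial_function (f i)"
  shows "pdiff m (\<lambda>x. \<Sum>i\<in>I. f i x) = (\<lambda>x. \<Sum>i\<in>I. pdiff m (f i) x)"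
  using assms
  by (induction I rule: finite_induct) (auto simp: pdiff_add real_polynomial_function_sum)

lemma pdiff_bounded_linear:
  fixes f :: "real^'n::finite \<Rightarrow> real"
  assumes "bounded_linear f"
  shows "pdiff m f = (\<lambda>x. f (axis m 1))"
proof
  fix x
  interpret bounded_linear f by fact
  have "((\<lambda>t. f (x + t *\<^sub>R axis m 1)) has_real_derivative f (axis m 1)) (at 0)"
    by (auto simp: add scaleR intro!: derivative_eq_intros)
  then show "pdiff m f x = f (axis m 1)"
    unfolding pdiff_def by (rule DERIV_imp_deriv)
qed

lemma real_polynomial_function_pdiff [intro]:
  assumes "real_polynomial_function f"
  shows "real_polynomial_function (pdiff m f)"
  using assms
  by (induction f rule: real_polynomial_function.induct)
    (auto simp: pdiff_bounded_linear pdiff_add pdiff_mult)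

lemma pdiff_commute:
  assumes "real_polynomial_function f"
  shows "pdiff m (pdiff l f) = pdiff l (pdiff m f)"
  using assms
proof (induction f rule: real_polynomial_function.induct)
  case (linear f)
  then show ?case by (simp add: pdiff_bounded_linear)
next
  case (const c)
  then show ?case by simp
next
  case (add f g)
  then show ?case by (simp add: pdiff_add real_polynomial_function_pdiff)
next
  case (mult f g)
  then show ?case
    by (simp add: pdiff_mult pdiff_add real_polynomial_function_pdiff
        real_polynomial_function_mult algebra_simps)
qed

lemma real_polynomial_function_component [intro]:
  "real_polynomial_function (\<lambda>x::real^'n::finite. x $ i)"
  by (intro real_polynomial_function_linear bounded_linear_vec_nth)

section \<open>Homogeneous polynomials\<close>

lemma homogeneous_polynomial_imp_real_polynomial_function:
  assumes "homogeneous_polynomial k p"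
  shows "real_polynomial_function p"
proof -
  obtain c where c:
    "p = (\<lambda>x. \<Sum>\<alpha>\<in>{\<alpha>. (\<Sum>i\<in>UNIV. \<alpha> i) = k}. c \<alpha> * (\<Prod>i\<in>UNIV. (x $ i) ^ \<alpha> i))"
    using assms unfolding homogeneous_polynomial_def fun_eq_iff by blast
  show ?thesis
  proof (cases "finite {\<alpha> :: 'a \<Rightarrow> nat. (\<Sum>i\<in>UNIV. \<alpha> i) = k}")
    case True
    then show ?thesis unfolding c
      by (intro real_polynomial_function_sum real_polynomial_function_mult
          real_polynomial_function_const real_polynomial_function_prod
          real_polynomial_function_power real_polynomial_function_component) auto
  next
    case False
    then show ?thesis unfolding c by (simp add: real_polynomial_function_const)
  qed
qed

lemma homogeneous_polynomial_scaleR: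
  assumes "homogeneous_polynomial k p"
  shows "p (s *\<^sub>R x) = s ^ k * p x"
proof -
  obtain c where c:
    "\<And>x. p x = (\<Sum>\<alpha>\<in>{\<alpha>. (\<Sum>i\<in>UNIV. \<alpha> i) = k}. c \<alpha> * (\<Prod>i\<in>UNIV. (x $ i) ^ \<alpha> i))"
    using assms unfolding homogeneous_polynomial_def by blast
  show ?thesis
    unfolding c sum_distrib_left
    by (rule sum.cong)
      (auto simp: power_mult_distrib prod.distrib power_sum)
qed

lemma euler_identity:
  assumes "homogeneous_polynomial k p"
  shows "(\<Sum>m\<in>UNIV. x $ m * pdiff m p x) = real k * p x"
proof -
  have "((\<lambda>s. p (s *\<^sub>R x)) has_derivative (\<lambda>t. \<Sum>m\<in>UNIV. (t *\<^sub>R x) $ m * pdiff m p x)) (at 1)"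
    by (rule has_derivative_compose[of "\<lambda>s. s *\<^sub>R x", where g = p])
      (auto intro!: derivative_eq_intros
        simp: has_derivative_pdiff[OF homogeneous_polynomial_imp_real_polynomial_function[OF assms]])
  moreover have "(\<lambda>t. \<Sum>m\<in>UNIV. (t *\<^sub>R x) $ m * pdiff m p x) = (*) (\<Sum>m\<in>UNIV. x $ m * pdiff m p x)"
    by (simp add: fun_eq_iff sum_distrib_left mult_ac)
  ultimately have "((\<lambda>s. p (s *\<^sub>R x)) has_real_derivative (\<Sum>m\<in>UNIV. x $ m * pdiff m p x)) (at 1)"
    by (simp add: has_field_derivative_def)
  moreover have "((\<lambda>s. p (s *\<^sub>R x)) has_real_derivative real k * p x) (at 1)"
    unfolding homogeneous_polynomial_scaleR[OF assms]
    by (auto intro!: derivative_eq_intros)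
  ultimately show ?thesis by (rule DERIV_unique)
qed

text \<open>Euler's operator \<open>x\<^sup>l \<partial>\<^sub>l\<close> and \<open>\<partial>\<^sub>m\<close> have commutator \<open>- \<partial>\<^sub>m\<close>, so a partial
  derivative is an eigenvector for the eigenvalue lowered by one.\<close>

lemma euler_identity_pdiff:
  assumes "homogeneous_polynomial k p"
  shows "(\<Sum>l\<in>UNIV. x $ l * pdiff l (pdiff m p) x) = (real k - 1) * pdiff m p x"
proof -
  have poly: "real_polynomial_function p"
    by (rule homogeneous_polynomial_imp_real_polynomial_function[OF assms])
  have "(\<lambda>x. \<Sum>l\<in>UNIV. x $ l * pdiff l p x) = (\<lambda>x. real k * p x)"
    using euler_identity[OF assms] by auto
  then have "pdiff m (\<lambda>x. \<Sum>l\<in>UNIV. x $ l * pdiff l p x) x = pdiff m (\<lambda>x. real k * p x) x"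
    by simp
  moreover have delta: "(\<Sum>l\<in>UNIV. (if m = l then 1 else 0) * pdiff l p x) = pdiff m p x"
    by (simp add: if_distrib if_distribR cong: if_cong)
  ultimately have "pdiff m p x + (\<Sum>l\<in>UNIV. x $ l * pdiff m (pdiff l p) x) = real k * pdiff m p x"
    using poly
    by (simp add: pdiff_sum pdiff_mult real_polynomial_function_mult real_polynomial_function_const
        real_polynomial_function_pdiff real_polynomial_function_component pdiff_component
        sum.distrib delta)
  then show ?thesis
    by (simp add: pdiff_commute[OF poly, of _ m] algebra_simps)
qed

section \<open>The Schouten bracket of bi-vector fields in components\<close>

lemma sum_permutes_2:
  "(\<Sum>\<sigma>\<in>{\<sigma>. \<sigma> permutes {..<2::nat}}. F \<sigma>) = F id + F (Transposition.transpose 0 1)"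
proof -
  have S: "{..<2::nat} = insert 0 {1}" by auto
  show ?thesis
    unfolding S by (subst sum_over_permutations_insert) (auto simp: o_def id_def)
qed

lemma sum_permutes_3:
  "(\<Sum>\<sigma>\<in>{\<sigma>. \<sigma> permutes {..<3::nat}}. F \<sigma>) =
     F id + F (Transposition.transpose 1 2) + F (Transposition.transpose 0 1) + F (Transposition.transpose 0 1 \<circ> Transposition.transpose 1 2)
     + F (Transposition.transpose 0 2) + F (Transposition.transpose 0 2 \<circ> Transposition.transpose 1 2)"
proof -
  have S: "{..<3::nat} = insert 0 (insert 1 {2})" by auto
  show ?thesis
    unfolding S
    apply (subst sum_over_permutations_insert, simp, simp)
    apply (subst sum_over_permutations_insert, simp, simp)
    by (simp add: add.assoc)
qed

lemmas permute_list_evaluation =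
  permute_list_def upt_rec sign_swap_id sign_compose permutation_swap_id Transposition.transpose_def

lemma wedge_1_1: "wedge 1 1 U W [i, j] x = U [i] x * W [j] x - U [j] x * W [i] x"
  by (simp add: wedge_def sum_permutes_2[unfolded numeral_2_eq_2] permute_list_evaluation sign_id)

text \<open>Skewness of the two-index factor pairs up the six permutations; each cyclic term occurs
  twice and cancels the normalising factor \<open>1! 2!\<close>.\<close>

lemma wedge_1_2:
  assumes "\<And>a b. W [a, b] x = - W [b, a] x"
  shows "wedge 1 2 U W [i, j, k] x =
    U [i] x * W [j, k] x + U [j] x * W [k, i] x + U [k] x * W [i, j] x"
  using assms[of i j] assms[of j k] assms[of k i]
  by (simp add: wedge_def sum_permutes_3[unfolded numeral_3_eq_3 numeral_2_eq_2 One_nat_def] permute_list_evaluation sign_id)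

lemma wedge_2_1:
  assumes "\<And>a b. U [a, b] x = - U [b, a] x"
  shows "wedge 2 1 U W [i, j, k] x =
    U [i, j] x * W [k] x + U [j, k] x * W [i] x + U [k, i] x * W [j] x"
  using assms[of i j] assms[of j k] assms[of k i]
  by (simp add: wedge_def sum_permutes_3 permute_list_evaluation sign_id)

lemma bivector_field_skew:
  assumes "multivector_field 2 P"
  shows "P [j, i] x = - P [i, j] x"
proof -
  have "Transposition.transpose 0 1 permutes {..<2::nat}"
    by (rule permutes_swap_id) auto
  then have "P (permute_list (Transposition.transpose 0 1) [i, j]) x = - P [i, j] x"
    using assms unfolding multivector_field_def by (auto simp: sign_swap_id)
  then show ?thesis by (simp add: permute_list_def upt_rec Transposition.transpose_def)
qed

text \<open>The two contractions in the Schouten bracket \<open>[P,P]\<close> agree by skewness, so the bracket is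
  twice the Jacobiator.\<close>

lemma poisson_jacobi:
  assumes "poisson P" and poly: "\<And>a b. real_polynomial_function (P [a, b])"
  shows "(\<Sum>m\<in>UNIV. P [i, m] x * pdiff m (P [j, k]) x + P [j, m] x * pdiff m (P [k, i]) x
            + P [k, m] x * pdiff m (P [i, j]) x) = 0"
proof -
  have skew: "P [b, a] y = - P [a, b] y" for a b y
    using assms(1) bivector_field_skew unfolding poisson_def by blast
  have dskew: "pdiff m (P [a, b]) y = - pdiff m (P [b, a]) y" for a b m y
    by (rule pdiff_uminus_eq[OF poly skew])
  have "0 = schouten 2 2 P P [i, j, k] x"
    using assms(1) unfolding poisson_def by simp
  also have "\<dots> = (\<Sum>m\<in>UNIV.
      wedge 1 2 (\<lambda>is. P (is @ [m])) (\<lambda>is. pdiff m (P is)) [i, j, k] x -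
      wedge 2 1 (\<lambda>is. pdiff m (P is)) (\<lambda>is. P (m # is)) [i, j, k] x)"
    by (simp add: schouten_def)
  also have "\<dots> = (\<Sum>m\<in>UNIV. 2 * (P [i, m] x * pdiff m (P [j, k]) x
      + P [j, m] x * pdiff m (P [k, i]) x + P [k, m] x * pdiff m (P [i, j]) x))"
  proof (rule sum.cong)
    fix m
    have "wedge 1 2 (\<lambda>is. P (is @ [m])) (\<lambda>is. pdiff m (P is)) [i, j, k] x =
        P [i, m] x * pdiff m (P [j, k]) x
      + P [j, m] x * pdiff m (P [k, i]) x + P [k, m] x * pdiff m (P [i, j]) x"
      by (subst wedge_1_2) (rule dskew, simp)
    moreover have "wedge 2 1 (\<lambda>is. pdiff m (P is)) (\<lambda>is. P (m # is)) [i, j, k] x =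
        pdiff m (P [i, j]) x * P [m, k] x + pdiff m (P [j, k]) x * P [m, i] x
        + pdiff m (P [k, i]) x * P [m, j] x"
      by (subst wedge_2_1) (rule dskew, simp)
    ultimately show "wedge 1 2 (\<lambda>is. P (is @ [m])) (\<lambda>is. pdiff m (P is)) [i, j, k] x -
      wedge 2 1 (\<lambda>is. pdiff m (P is)) (\<lambda>is. P (m # is)) [i, j, k] x =
      2 * (P [i, m] x * pdiff m (P [j, k]) x
      + P [j, m] x * pdiff m (P [k, i]) x + P [k, m] x * pdiff m (P [i, j]) x)"
      by (simp add: skew[of i m] skew[of j m] skew[of k m] algebra_simps)
  qed simp
  finally show ?thesis by (simp add: sum_distrib_left[symmetric] del: distrib_left_numeral)
qed

section \<open>The trace of a Poisson structure is an infinitesimal symmetry\<close>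

text \<open>This is \<open>[X,\<Pi>] = 0\<close> for \<open>X = D\<Pi>\<close>, obtained as the divergence of the Jacobi identity:
  apply \<open>\<partial>\<^sub>k\<close> to the \<open>(i,j,k)\<close> component and sum over \<open>k\<close>. Where both factors are
  differentiated once, two of the three cyclic terms cancel each other and the third contains the
  divergence \<open>- X\<close>; among the second derivatives, one term pairs the skew \<open>\<Pi>\<^sup>k\<^sup>m\<close> with a
  symmetric Hessian, and the other two are derivatives of \<open>X\<close> along the rows \<open>i\<close> and
  \<open>j\<close> of \<open>\<Pi>\<close>.\<close>

lemma trace_preserves_poisson:
  fixes p :: "'n \<Rightarrow> 'n \<Rightarrow> real^'n::finite \<Rightarrow> real"
  assumes poly: "\<And>a b. real_polynomial_function (p a b)"
    and skew: "\<And>a b x. p b a x = - p a b x"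
    and jacobi: "\<And>i j k x. (\<Sum>m\<in>UNIV. p i m x * pdiff m (p j k) x
        + p j m x * pdiff m (p k i) x + p k m x * pdiff m (p i j) x) = 0"
  defines "X \<equiv> \<lambda>i x. \<Sum>m\<in>UNIV. pdiff m (p i m) x"
  shows "(\<Sum>m\<in>UNIV. p i m x * pdiff m (X j) x) - (\<Sum>m\<in>UNIV. p j m x * pdiff m (X i) x)
    = (\<Sum>m\<in>UNIV. X m x * pdiff m (p i j) x)"
proof -
  note poly_intros = poly real_polynomial_function_pdiff real_polynomial_function_mult
    real_polynomial_function_add
  have dskew: "pdiff m (p b a) = (\<lambda>y. - pdiff m (p a b) y)" for a b m
    by (rule ext, rule pdiff_uminus_eq[OF poly skew])
  have ddskew: "pdiff l (pdiff m (p b a)) y = - pdiff l (pdiff m (p a b)) y" for a b m l y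
    by (subst dskew) (simp add: pdiff_minus poly_intros)
  have dX: "pdiff m (X j) x = (\<Sum>k\<in>UNIV. pdiff k (pdiff m (p j k)) x)" for m j
    unfolding X_def by (simp add: pdiff_sum poly_intros pdiff_commute[OF poly, of m])
  have "0 = (\<Sum>k\<in>UNIV. pdiff k (\<lambda>x. \<Sum>m\<in>UNIV. p i m x * pdiff m (p j k) x
        + p j m x * pdiff m (p k i) x + p k m x * pdiff m (p i j) x) x)"
    unfolding jacobi by simp
  also have "\<dots> = (\<Sum>k\<in>UNIV. \<Sum>m\<in>UNIV. pdiff k (p i m) x * pdiff m (p j k) x)
      + (\<Sum>k\<in>UNIV. \<Sum>m\<in>UNIV. p i m x * pdiff k (pdiff m (p j k)) x)
      + (\<Sum>k\<in>UNIV. \<Sum>m\<in>UNIV. pdiff k (p j m) x * pdiff m (p k i) x)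
      + (\<Sum>k\<in>UNIV. \<Sum>m\<in>UNIV. p j m x * pdiff k (pdiff m (p k i)) x)
      + (\<Sum>k\<in>UNIV. \<Sum>m\<in>UNIV. pdiff k (p k m) x * pdiff m (p i j) x)
      + (\<Sum>k\<in>UNIV. \<Sum>m\<in>UNIV. p k m x * pdiff k (pdiff m (p i j)) x)"
    by (simp add: pdiff_sum pdiff_add pdiff_mult poly_intros) (simp add: sum.distrib algebra_simps)
  also have "(\<Sum>k\<in>UNIV. \<Sum>m\<in>UNIV. pdiff k (p j m) x * pdiff m (p k i) x) =
      - (\<Sum>k\<in>UNIV. \<Sum>m\<in>UNIV. pdiff k (p i m) x * pdiff m (p j k) x)"
    by (subst sum.swap) (simp add: dskew[of _ i] sum_negf mult.commute)
  also have "(\<Sum>k\<in>UNIV. \<Sum>m\<in>UNIV. p i m x * pdiff k (pdiff m (p j k)) x) =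
      (\<Sum>m\<in>UNIV. p i m x * pdiff m (X j) x)"
    by (subst sum.swap) (simp add: dX sum_distrib_left)
  also have "(\<Sum>k\<in>UNIV. \<Sum>m\<in>UNIV. p j m x * pdiff k (pdiff m (p k i)) x) =
      - (\<Sum>m\<in>UNIV. p j m x * pdiff m (X i) x)"
    by (subst sum.swap) (simp add: dX sum_distrib_left ddskew[of _ _ _ i] sum_negf)
  also have "(\<Sum>k\<in>UNIV. \<Sum>m\<in>UNIV. pdiff k (p k m) x * pdiff m (p i j) x) =
      - (\<Sum>m\<in>UNIV. X m x * pdiff m (p i j) x)"
  proof -
    have "pdiff k (p k m) x = - pdiff k (p m k) x" for k m
      by (subst dskew) simp
    then show ?thesis
      unfolding X_def
      by (subst sum.swap) (simp only: sum_distrib_right sum_negf mult_minus_left)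
  qed
  also have "(\<Sum>k\<in>UNIV. \<Sum>m\<in>UNIV. p k m x * pdiff k (pdiff m (p i j)) x) = 0"
  proof -
    let ?S = "\<Sum>k\<in>UNIV. \<Sum>m\<in>UNIV. p k m x * pdiff k (pdiff m (p i j)) x"
    have flip: "p k m x * pdiff k (pdiff m (p i j)) x = - (p m k x * pdiff m (pdiff k (p i j)) x)"
      for k m
      using skew[of k m x] by (simp add: pdiff_commute[OF poly, of k m])
    have "?S = (\<Sum>k\<in>UNIV. \<Sum>m\<in>UNIV. - (p m k x * pdiff m (pdiff k (p i j)) x))"
      by (intro sum.cong refl flip)
    also have "\<dots> = - (\<Sum>k\<in>UNIV. \<Sum>m\<in>UNIV. p m k x * pdiff m (pdiff k (p i j)) x)"
      by (simp only: sum_negf)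
    also have "\<dots> = - ?S"
      by (subst sum.swap) (rule refl)
    finally show ?thesis by simp
  qed
  finally show ?thesis by simp
qed

section \<open>The trace divides a simple Poisson structure\<close>

text \<open>Here \<open>q\<close> is \<open>p - (X \<and> E) / c\<close>, and the conclusion is \<open>X \<and> p = 0\<close> in components.
  The argument is independent of the value of \<open>c\<close>: it works whenever subtracting some non-zero
  multiple of \<open>X \<and> E\<close> preserves the Jacobi identity.\<close>

lemma trace_wedge_eq_0:
  fixes p :: "'n \<Rightarrow> 'n \<Rightarrow> real^'n::finite \<Rightarrow> real" and k :: nat and c :: real
  assumes hom: "\<And>a b. homogeneous_polynomial k (p a b)"
    and skew: "\<And>a b x. p b a x = - p a b x"
    and jacobi: "\<And>i j k x. (\<Sum>m\<in>UNIV. p i m x * pdiff m (p j k) x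
        + p j m x * pdiff m (p k i) x + p k m x * pdiff m (p i j) x) = 0"
  defines "X \<equiv> \<lambda>i x. \<Sum>m\<in>UNIV. pdiff m (p i m) x"
  defines "q \<equiv> \<lambda>i j x. p i j x - (X i x * x $ j - X j x * x $ i) / c"
  assumes jacobi': "\<And>i j k x. (\<Sum>m\<in>UNIV. q i m x * pdiff m (q j k) x
        + q j m x * pdiff m (q k i) x + q k m x * pdiff m (q i j) x) = 0"
    and "k \<noteq> 2" "c \<noteq> 0"
  shows "X i x * p j l x + X j x * p l i x + X l x * p i j x = 0"
proof -
  have poly: "real_polynomial_function (p a b)" for a b
    by (rule homogeneous_polynomial_imp_real_polynomial_function[OF hom])
  define b where "b = inverse c"
  have polyX: "real_polynomial_function (X a)" for a
    unfolding X_def by (intro real_polynomial_function_sum real_polynomial_function_pdiff poly) auto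
  note poly_intros = poly polyX real_polynomial_function_mult
    real_polynomial_function_const real_polynomial_function_component real_polynomial_function_diff
  have q_alt: "q i j = (\<lambda>x. p i j x - b * (X i x * x $ j - X j x * x $ i))" for i j
    by (auto simp: q_def b_def field_simps)
  define \<delta> :: "'n \<Rightarrow> 'n \<Rightarrow> real" where "\<delta> m j = (if m = j then 1 else 0)" for m j
  have dq: "pdiff m (q i j) x = pdiff m (p i j) x
      - b * (pdiff m (X i) x * x $ j + X i x * \<delta> m j
           - pdiff m (X j) x * x $ i - X j x * \<delta> m i)" for m i j
    unfolding q_alt
    by (simp add: pdiff_diff pdiff_mult pdiff_component poly_intros \<delta>_def)
  have eulerX: "(\<Sum>m\<in>UNIV. x $ m * pdiff m (X j) x) = (real k - 1) * X j x" for j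
  proof -
    have "(\<Sum>m\<in>UNIV. x $ m * pdiff m (X j) x) =
        (\<Sum>m\<in>UNIV. \<Sum>l\<in>UNIV. x $ m * pdiff m (pdiff l (p j l)) x)"
      unfolding X_def by (simp add: pdiff_sum poly real_polynomial_function_pdiff sum_distrib_left)
    also have "\<dots> = (\<Sum>l\<in>UNIV. (real k - 1) * pdiff l (p j l) x)"
      by (subst sum.swap) (simp add: euler_identity_pdiff[OF hom])
    finally show ?thesis by (simp add: X_def sum_distrib_left)
  qed
  (* Expand one cyclic term of the Jacobiator of q. A is the Jacobiator term of p; B and C are the
     two halves of [X,p] and will cancel by trace_preserves_poisson; F, the derivative of X along
     itself, drops out of the cyclic sum together with the rest of the term in b^2. *)
  define A where "A i j l = (\<Sum>m\<in>UNIV. p i m x * pdiff m (p j l) x)" for i j l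
  define B where "B i j = (\<Sum>m\<in>UNIV. p i m x * pdiff m (X j) x)" for i j
  define C where "C i j = (\<Sum>m\<in>UNIV. X m x * pdiff m (p i j) x)" for i j
  define F where "F j = (\<Sum>m\<in>UNIV. X m x * pdiff m (X j) x)" for j
  have T: "(\<Sum>m\<in>UNIV. q i m x * pdiff m (q j l) x) =
      A i j l - b * (B i j * x $ l + X j x * p i l x - B i l * x $ j - X l x * p i j x)
      - b * (X i x * (real k * p j l x) - x $ i * C j l)
      + b\<^sup>2 * (X i x * ((real k - 1) * X j x * x $ l + X j x * x $ l
                        - (real k - 1) * X l x * x $ j - X l x * x $ j)
              - x $ i * (F j * x $ l + X j x * X l x - F l * x $ j - X l x * X j x))" for i j l
  proof -
    have contract: "(\<Sum>m\<in>UNIV. v m * pdiff m (q j l) x) =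
        (\<Sum>m\<in>UNIV. v m * pdiff m (p j l) x)
        - b * ((\<Sum>m\<in>UNIV. v m * pdiff m (X j) x) * x $ l + X j x * v l
             - (\<Sum>m\<in>UNIV. v m * pdiff m (X l) x) * x $ j - X l x * v j)" for v
    proof -
      have delta: "(\<Sum>m\<in>UNIV. v m * \<delta> m a) = v a" for a
        by (simp add: \<delta>_def if_distrib if_distribR cong: if_cong)
      have "(\<Sum>m\<in>UNIV. v m * pdiff m (q j l) x) = (\<Sum>m\<in>UNIV. v m * pdiff m (p j l) x
          - b * ((v m * pdiff m (X j) x) * x $ l + X j x * (v m * \<delta> m l)
               - (v m * pdiff m (X l) x) * x $ j - X l x * (v m * \<delta> m j)))"
        by (intro sum.cong refl) (simp add: dq algebra_simps)
      then show ?thesis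
        by (simp only: sum.distrib sum_subtractf sum_distrib_left[symmetric]
            sum_distrib_right[symmetric] delta)
    qed
    have "(\<Sum>m\<in>UNIV. q i m x * pdiff m (q j l) x) = (\<Sum>m\<in>UNIV. p i m x * pdiff m (q j l) x
      - b * (X i x * (x $ m * pdiff m (q j l) x) - x $ i * (X m x * pdiff m (q j l) x)))"
      by (intro sum.cong refl) (simp add: q_alt[of i] algebra_simps)
    also have "\<dots> = (\<Sum>m\<in>UNIV. p i m x * pdiff m (q j l) x)
      - b * (X i x * (\<Sum>m\<in>UNIV. x $ m * pdiff m (q j l) x)
             - x $ i * (\<Sum>m\<in>UNIV. X m x * pdiff m (q j l) x))"
      by (simp only: sum_subtractf sum_distrib_left[symmetric])
    finally show ?thesis
      unfolding contract eulerX euler_identity[OF hom]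
        A_def[symmetric] B_def[symmetric] C_def[symmetric] F_def[symmetric]
      by (simp add: algebra_simps power2_eq_square)
  qed
  have A0: "A i j l + A j l i + A l i j = 0"
    using jacobi[where i = i and j = j and k = l and x = x] by (simp add: A_def sum.distrib)
  have L: "C i j = B i j - B j i" for i j
    using trace_preserves_poisson[OF poly skew jacobi, where i = i and j = j and x = x]
    by (simp add: B_def C_def X_def)
  have "(\<Sum>m\<in>UNIV. q i m x * pdiff m (q j l) x) + (\<Sum>m\<in>UNIV. q j m x * pdiff m (q l i) x)
      + (\<Sum>m\<in>UNIV. q l m x * pdiff m (q i j) x) = 0"
    using jacobi'[where i = i and j = j and k = l and x = x] by (simp add: sum.distrib)
  then have "(A i j l + A j l i + A l i j)
      - b * (real k - 2) * (X i x * p j l x + X j x * p l i x + X l x * p i j x) = 0"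
    unfolding T L skew[of l i] skew[of i j] skew[of j l]
    by (simp add: algebra_simps power2_eq_square)
  then show ?thesis
    using A0 \<open>c \<noteq> 0\<close> \<open>k \<noteq> 2\<close> by (simp add: b_def)
qed

section \<open>Decomposability and rank\<close>

text \<open>Polynomial functions have no zero divisors: on the line through points where \<open>f\<close> and
  \<open>g\<close> do not vanish, both would have only finitely many zeros, but together their zeros exhaust the line.\<close>

lemma real_polynomial_function_mult_eq_0:
  fixes f g :: "'a::real_normed_vector \<Rightarrow> real"
  assumes f: "real_polynomial_function f" and g: "real_polynomial_function g"
    and fg: "\<And>x. f x * g x = 0" and "f y \<noteq> 0"
  shows "g x = 0"
proof (rule ccontr)
  assume "g x \<noteq> 0"
  define \<gamma> where "\<gamma> t = x + t *\<^sub>R (y - x)" for t :: real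
  have finite_zeros: "finite {t. h (\<gamma> t) = 0}"
    if h: "real_polynomial_function h" and "h (\<gamma> s) \<noteq> 0" for h :: "'a \<Rightarrow> real" and s
  proof -
    have "polynomial_function \<gamma>"
      unfolding \<gamma>_def
      by (intro polynomial_function_add polynomial_function_const polynomial_function_bounded_linear
          bounded_linear_scaleR_left)
    then have "real_polynomial_function (h \<circ> \<gamma>)"
      using h by (rule real_polynomial_function_compose)
    then obtain a n where a: "h \<circ> \<gamma> = (\<lambda>t. \<Sum>i\<le>n. a i * t ^ i)"
      unfolding real_polynomial_function_iff_sum by blast
    then have a': "h (\<gamma> t) = (\<Sum>i\<le>n. a i * t ^ i)" for t
      by (metis comp_apply)
    with \<open>h (\<gamma> s) \<noteq> 0\<close> obtain i where "i \<le> n" "a i \<noteq> 0"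
      by (metis (no_types, lifting) atMost_iff mult_zero_left sum.neutral)
    then show ?thesis
      unfolding a' using polyfun_rootbound by blast
  qed
  have "finite {t. f (\<gamma> t) = 0}" "finite {t. g (\<gamma> t) = 0}"
    using finite_zeros[OF f, of 1] finite_zeros[OF g, of 0] \<open>f y \<noteq> 0\<close> \<open>g x \<noteq> 0\<close>
    by (simp_all add: \<gamma>_def)
  moreover have "UNIV = {t. f (\<gamma> t) = 0} \<union> {t. g (\<gamma> t) = 0}"
    using fg by auto
  ultimately have "finite (UNIV :: real set)"
    by (metis finite_UnI)
  then show False
    using infinite_UNIV_char_0 by blast
qed

text \<open>Contracting \<open>v \<and> w = 0\<close> with a covector on which \<open>v\<close> takes the value one gives
  \<open>w = v \<and> u\<close>, where \<open>u\<close> is the contraction of \<open>w\<close>; the covector used is the coordinate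
  \<open>e\<close> divided by \<open>v e\<close>.\<close>

lemma pluecker_of_divisible:
  fixes w :: "'n \<Rightarrow> 'n \<Rightarrow> real"
  assumes skew: "\<And>i j. w j i = - w i j"
    and div: "\<And>i j l. v i * w j l + v j * w l i + v l * w i j = 0"
    and "v e \<noteq> 0"
  shows "w a b * w i j - w a i * w b j + w a j * w b i = 0"
proof -
  define u where "u j = w e j / v e" for j
  have w: "w i j = v i * u j - v j * u i" for i j
    using div[of e i j] skew[of j e] \<open>v e \<noteq> 0\<close> by (simp add: u_def field_simps)
  show ?thesis unfolding w by (simp add: algebra_simps)
qed

text \<open>If the entry \<open>(a,b)\<close> is non-zero, the relations express every row through rows \<open>a\<close>
  and \<open>b\<close>.\<close>

lemma rank_le_2_of_pluecker:
  fixes M :: "real^'n::finite^'n"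
  assumes pluecker: "\<And>a b i j. M$a$b * M$i$j - M$a$i * M$b$j + M$a$j * M$b$i = 0"
  shows "rank M \<le> 2"
proof (cases "M = 0")
  case True
  then show ?thesis by simp
next
  case False
  then obtain a b where ab: "M$a$b \<noteq> 0"
    by (auto simp: vec_eq_iff)
  have "rows M \<subseteq> span {row a M, row b M}"
  proof (clarsimp simp: rows_def)
    fix i
    have "row i M = (- (M$b$i) / M$a$b) *\<^sub>R row a M + (M$a$i / M$a$b) *\<^sub>R row b M"
      using pluecker[of a b i] ab by (auto simp: vec_eq_iff row_def field_simps)
    then show "row i M \<in> span {row a M, row b M}"
      by (metis insertCI span_add span_base span_scale)
  qed
  then have "rank M \<le> card {row a M, row b M}"
    unfolding row_rank_def by (intro dim_le_card) auto
  also have "\<dots> \<le> 2" by (simp add: card_insert_if)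
  finally show ?thesis .
qed

lemma rank_skew_matrix_ge_2:
  fixes M :: "real^'n::finite^'n"
  assumes skew: "\<And>i j. M$j$i = - M$i$j" and "M \<noteq> 0"
  shows "rank M \<ge> 2"
proof -
  obtain a b where ab: "M$a$b \<noteq> 0"
    using \<open>M \<noteq> 0\<close> by (auto simp: vec_eq_iff)
  have diag: "M$i$i = 0" for i using skew[of i i] by simp
  have "row b M \<noteq> c *\<^sub>R row a M" for c
  proof
    assume "row b M = c *\<^sub>R row a M"
    then have "row b M $ a = (c *\<^sub>R row a M) $ a" by simp
    then show False using ab diag[of a] skew[of a b] by (simp add: row_def)
  qed
  moreover have "row a M \<noteq> 0" using ab by (auto simp: row_def vec_eq_iff)
  ultimately have "independent {row b M, row a M}" "row b M \<noteq> row a M"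
    by (auto simp: independent_insert span_singleton) (metis scaleR_one)
  then have "card {row b M, row a M} \<le> dim (rows M)"
    by (intro independent_card_le_dim) (auto simp: rows_def)
  then show ?thesis
    using \<open>row b M \<noteq> row a M\<close> by (simp add: row_rank_def)
qed

theorem proposition4p2:
  fixes k :: nat and P :: "('n::finite) mvf"
  assumes "k \<ge> 3"
    and "P \<in> hom_mvf k 2"
    and "simple_poisson k P"
    and "trace_op P \<noteq> (\<lambda>js x. 0)"
  shows "bivector_rank P = 2"
proof -
  define c where "c = real CARD('n) + real k - 2"
  define p where "p a b = P [a, b]" for a b
  define X where "X a x = (\<Sum>m\<in>UNIV. pdiff m (p a m) x)" for a x
  have "c \<noteq> 0" using \<open>k \<ge> 3\<close> unfolding c_def by simp
  have mvf: "multivector_field 2 P" and "poisson P" and free: "poisson (trace_free_part k 2 P)"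
    using assms(3) by (auto simp: simple_poisson_def poisson_def)
  have hom: "homogeneous_polynomial k (p a b)" for a b
    using assms(2) by (simp add: hom_mvf_def p_def)
  then have poly: "real_polynomial_function (p a b)" for a b
    by (rule homogeneous_polynomial_imp_real_polynomial_function)
  have skew: "p b a x = - p a b x" for a b x
    unfolding p_def by (rule bivector_field_skew[OF mvf])
  have polyX: "real_polynomial_function (X a)" for a
    unfolding X_def by (intro real_polynomial_function_sum real_polynomial_function_pdiff poly) auto
  have free_part: "trace_free_part k 2 P [a, b] = (\<lambda>x. p a b x - (X a x * x $ b - X b x * x $ a) / c)"
    for a b
    by (auto simp: trace_free_part_def wedge_1_1 trace_op_def euler_field_def c_def p_def X_def
        diff_divide_distrib simp flip: One_nat_def)
  have free_poly: "real_polynomial_function (trace_free_part k 2 P [a, b])" for a b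
    unfolding free_part
    by (intro real_polynomial_function_diff real_polynomial_function_divide
        real_polynomial_function_mult poly polyX real_polynomial_function_component)
  have div: "X i x * p j l x + X j x * p l i x + X l x * p i j x = 0" for i j l x
    unfolding X_def
  proof (rule trace_wedge_eq_0[OF hom skew _ _ _ \<open>c \<noteq> 0\<close>])
    show "k \<noteq> 2" using \<open>k \<ge> 3\<close> by simp
  qed (use poisson_jacobi[OF \<open>poisson P\<close>] poisson_jacobi[OF free free_poly] poly
      in \<open>simp_all add: p_def[symmetric] free_part X_def\<close>)

  obtain js y where "trace_op P js y \<noteq> 0"
    using assms(4) by (auto simp: fun_eq_iff)
  have "length js = 1"
  proof (rule ccontr)
    assume "length js \<noteq> 1"
    then have "P (js @ [m]) = (\<lambda>x. 0)" for m
      using mvf by (auto simp: multivector_field_def)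
    then show False using \<open>trace_op P js y \<noteq> 0\<close> by (simp add: trace_op_def)
  qed
  then obtain e where "js = [e]" by (cases js) auto
  then have Xe: "X e y \<noteq> 0"
    using \<open>trace_op P js y \<noteq> 0\<close> by (simp add: trace_op_def X_def p_def)

  have pluecker: "p a b x * p i j x - p a i x * p b j x + p a j x * p b i x = 0" for a b i j x
  proof (rule real_polynomial_function_mult_eq_0[of "X e"])
    show "real_polynomial_function (\<lambda>x. p a b x * p i j x - p a i x * p b j x + p a j x * p b i x)"
      by (intro real_polynomial_function_diff real_polynomial_function_add
          real_polynomial_function_mult poly)
    show "X e x * (p a b x * p i j x - p a i x * p b j x + p a j x * p b i x) = 0" for x
    proof (cases "X e x = 0")
      case False
      have "p a b x * p i j x - p a i x * p b j x + p a j x * p b i x = 0"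
        by (rule pluecker_of_divisible[of "\<lambda>i j. p i j x" "\<lambda>i. X i x" e, OF skew div False])
      then show ?thesis by (simp only: mult_zero_right)
    qed simp
  qed (rule polyX, rule Xe)
  have le: "rank (bivector_matrix P x) \<le> 2" for x
    using pluecker by (intro rank_le_2_of_pluecker) (simp add: bivector_matrix_def p_def)

  have "\<exists>a b x. p a b x \<noteq> 0"
  proof (rule ccontr)
    assume "\<not> ?thesis"
    then have "p a b = (\<lambda>x. 0)" for a b by auto
    then show False using Xe by (simp add: X_def)
  qed
  then obtain x where "bivector_matrix P x \<noteq> 0"
    by (force simp: bivector_matrix_def p_def vec_eq_iff)
  then have "rank (bivector_matrix P x) \<ge> 2"
    by (rule rank_skew_matrix_ge_2[rotated]) (simp add: bivector_matrix_def skew[unfolded p_def, symmetric])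
  with le have "rank (bivector_matrix P x) = 2"
    by (metis le_antisym)
  moreover have "finite (range (\<lambda>x. rank (bivector_matrix P x)))"
    by (rule finite_subset[of _ "{..2}"]) (use le in auto)
  ultimately show ?thesis
    unfolding bivector_rank_def using le by (intro Max_eqI) (auto intro: rev_image_eqI)
qed

end
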